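(* Let $R$ be a valuation domain and $\mathcal{C}=\{*_i\}_{i=0}^{\infty}$ a standard, countable descending chain of finite type and stable semistar operations on $R$. Then the following are equivalent. (1) $*_{\mathcal{C}}$ is of finite type. (2) $\nu_{\mathcal{C}}$ has finite range. (3) $\bigcap_{n\ge0}G(\nu_{\mathcal{C}},n)$ is a localizing system of $R$ of finite type. (4) $\bigcap_{n\ge0}G(\nu_{\mathcal{C}},n)=G(\nu_{\mathcal{C}},m)$ for some $m\in\mathbb{N}$.
   Context: $R$ has quotient field $K$; $\mathcal{S}(R)$ is the set of all ideals of $R$, $\overline{F}(R)$ the set of nonzero $R$-submodules of $K$, $\mathbb{N}=\{0,1,2,\ldots\}$, $\overline{\mathbb{N}}=\mathbb{N}\cup\{\infty\}$. Semistar operation: a map $*:\overline{F}(R)\to\overline{F}(R)$, $I\mapsto I^*$, such that for all $I,J\in\overline{F}(R)$ and $x\in K\setminus\{0\}$: $I\subseteq I^*$; $I\subseteq J$ implies $I^*\subseteq J^*$; $(xI)^*=xI^*$; $(I^* )^*=I^*$. It is stable if $(I\cap J)^*=I^*\cap J^*$ for all $I,J\in\overline{F}(R)$. It is of finite type if $I^*=\bigcup\{J^*\mid J\subseteq I,\ J\text{ a nonzero finitely generated }R\text{-submodule of }K\}$ for all $I\in\overline{F}(R)$. Write $*\ge*'$ if $I^*\supseteq I^{*'}$ for all $I\in\overline{F}(R)$; $e$ denotes $I_e=K$ for all $I\in\overline{F}(R)$. A standard, countable descending chain of finite type, stable semistar operations is a family $\mathcal{C}=\{*_i\}_{i=0}^\infty$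 of finite type, stable semistar operations with $*_i\ge*_{i+1}$ for all $i\ge0$ and $*_0=e$. The semistar operation $*_{\mathcal{C}}$ is $I^{*_{\mathcal{C}}}=\bigcap_{i\ge0}I^{*_i}$ for $I\in\overline{F}(R)$. The function $\nu_{\mathcal{C}}:\mathcal{S}(R)\to\overline{\mathbb{N}}$ is given by $\nu_{\mathcal{C}}(0)=0$ and $\nu_{\mathcal{C}}(I)=\sup\{k\ge 0\mid I^{*_k}=R^{*_k}\}$ for $I\ne0$. For $n\ge0$, $G(\nu_{\mathcal{C}},n)=\{J\in\mathcal{S}(R)\mid\nu_{\mathcal{C}}(J)\ge n\}$. A localizing system $\mathcal{F}$ of $R$ is a nonempty family of ideals such that (LS1) if $I\in\mathcal{F}$ and $J\supseteq I$ is an ideal of $R$ then $J\in\mathcal{F}$; (LS2) if $I\in\mathcal{F}$ and $J$ is an ideal of $R$ with $(J:_Ri)=\{r\in R\mid ri\in J\}\in\mathcal{F}$ for all $i\in I$, then $J\in\mathcal{F}$. It is of finite type if every $I\in\mathcal{F}$ contains a finitely generated ideal $J$ with $J\in\mathcal{F}$. *)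

theory Defs
  imports
    "HOL-Computational_Algebra.Polynomial_Factorial"
    "HOL-Library.Extended_Nat"
begin

(* The domain R is the whole type 'a :: idom, its quotient field K is the type 'a fract, and
   to_fract is the embedding of R into K.  Ideals of R and R-submodules of K are the submodules
   ("subspace") of R over itself and of K over R, in the sense of the locale module. *)

lemma module_ring: "module ((*) :: 'a::comm_ring_1 \<Rightarrow> 'a \<Rightarrow> 'a)"
  by unfold_locales (simp_all add: distrib_left distrib_right mult.assoc)

definition frac_scale :: "'a::idom \<Rightarrow> 'a fract \<Rightarrow> 'a fract" where
  "frac_scale r x = to_fract r * x"

lemma module_frac: "module (frac_scale :: 'a::idom \<Rightarrow> 'a fract \<Rightarrow> 'a fract)"
  by unfold_locales (simp_all add: frac_scale_def distrib_left distrib_right mult.assoc)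

definition ideals :: "'a::comm_ring_1 set set" where
  "ideals = {I. module.subspace (*) I}"

definition fg_ideals :: "'a::comm_ring_1 set set" where
  "fg_ideals = {I. \<exists>A. finite A \<and> I = module.span (*) A}"

definition Fbar :: "'a::idom fract set set" where
  "Fbar = {I. module.subspace frac_scale I \<and> I \<noteq> {0}}"

definition fg_Fbar :: "'a::idom fract set set" where
  "fg_Fbar = {I \<in> Fbar. \<exists>A. finite A \<and> I = module.span frac_scale A}"

definition valuation_domain :: "'a::idom itself \<Rightarrow> bool" where
  "valuation_domain _ \<longleftrightarrow>
     (\<forall>x :: 'a fract. x \<noteq> 0 \<longrightarrow> x \<in> range to_fract \<or> inverse x \<in> range to_fract)"

(* An operation on Fbar is encoded as a function on all subsets of K; only its values on Fbar
   are constrained or used, and equality of operations means equality on Fbar. *)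

definition semistar :: "('a::idom fract set \<Rightarrow> 'a fract set) \<Rightarrow> bool" where
  "semistar s \<longleftrightarrow>
     (\<forall>I\<in>Fbar. s I \<in> Fbar) \<and>
     (\<forall>I\<in>Fbar. I \<subseteq> s I) \<and>
     (\<forall>I\<in>Fbar. \<forall>J\<in>Fbar. I \<subseteq> J \<longrightarrow> s I \<subseteq> s J) \<and>
     (\<forall>I\<in>Fbar. \<forall>x. x \<noteq> 0 \<longrightarrow> s ((\<lambda>y. x * y) ` I) = (\<lambda>y. x * y) ` s I) \<and>
     (\<forall>I\<in>Fbar. s (s I) = s I)"

definition semistar_stable :: "('a::idom fract set \<Rightarrow> 'a fract set) \<Rightarrow> bool" where
  "semistar_stable s \<longleftrightarrow> (\<forall>I\<in>Fbar. \<forall>J\<in>Fbar. s (I \<inter> J) = s I \<inter> s J)"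

definition semistar_finite_type :: "('a::idom fract set \<Rightarrow> 'a fract set) \<Rightarrow> bool" where
  "semistar_finite_type s \<longleftrightarrow> (\<forall>I\<in>Fbar. s I = (\<Union>J \<in> {J \<in> fg_Fbar. J \<subseteq> I}. s J))"

definition semistar_ge ::
    "('a::idom fract set \<Rightarrow> 'a fract set) \<Rightarrow> ('a fract set \<Rightarrow> 'a fract set) \<Rightarrow> bool" where
  "semistar_ge s t \<longleftrightarrow> (\<forall>I\<in>Fbar. t I \<subseteq> s I)"

definition semistar_e :: "'a::idom fract set \<Rightarrow> 'a fract set" where
  "semistar_e I = UNIV"

definition standard_chain :: "(nat \<Rightarrow> 'a::idom fract set \<Rightarrow> 'a fract set) \<Rightarrow> bool" where
  "standard_chain C \<longleftrightarrow>
     (\<forall>i. semistar (C i) \<and> semistar_finite_type (C i) \<and> semistar_stable (C i)) \<and>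
     (\<forall>i. semistar_ge (C i) (C (Suc i))) \<and>
     (\<forall>I\<in>Fbar. C 0 I = semistar_e I)"

definition chain_star ::
    "(nat \<Rightarrow> 'a::idom fract set \<Rightarrow> 'a fract set) \<Rightarrow> 'a fract set \<Rightarrow> 'a fract set" where
  "chain_star C I = (\<Inter>i. C i I)"

definition chain_nu ::
    "(nat \<Rightarrow> 'a::idom fract set \<Rightarrow> 'a fract set) \<Rightarrow> 'a set \<Rightarrow> enat" where
  "chain_nu C I =
     (if I = {0} then 0
      else (SUP k \<in> {k. C k (to_fract ` I) = C k (range to_fract)}. enat k))"

definition G :: "('a::comm_ring_1 set \<Rightarrow> enat) \<Rightarrow> nat \<Rightarrow> 'a set set" where
  "G \<nu> n = {J \<in> ideals. \<nu> J \<ge> enat n}"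

definition localizing_system :: "'a::comm_ring_1 set set \<Rightarrow> bool" where
  "localizing_system F \<longleftrightarrow>
     F \<noteq> {} \<and> F \<subseteq> ideals \<and>
     (\<forall>I\<in>F. \<forall>J\<in>ideals. I \<subseteq> J \<longrightarrow> J \<in> F) \<and>
     (\<forall>I\<in>F. \<forall>J\<in>ideals. (\<forall>i\<in>I. {r. r * i \<in> J} \<in> F) \<longrightarrow> J \<in> F)"

definition finite_type_family :: "'a::comm_ring_1 set set \<Rightarrow> bool" where
  "finite_type_family F \<longleftrightarrow> (\<forall>I\<in>F. \<exists>J\<in>F. J \<in> fg_ideals \<and> J \<subseteq> I)"

end

theory Submission
  imports Defs
begin

text \<open>
  A finite type stable semistar operation is determined by the family of ideals that it sends to
  the same module as \<open>R\<close>, and over a valuation domain each such ideal contains a principal one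
  of the same family.  If \<open>G n\<close> never equals the intersection of the chain \<open>G 0, G 1, \<dots>\<close>, the
  elements whose principal ideal leaves the chain form an ideal \<open>P\<close>; this \<open>P\<close> lies in every
  \<open>G n\<close>, while no finitely generated (hence principal) subideal of \<open>P\<close> does.  So neither the
  intersection nor the semistar operation of the chain is of finite type.  If the chain does
  stabilise at \<open>m\<close>, then so do the semistar operations.
\<close>

subsection \<open>Ideals and submodules of the quotient field\<close>

text \<open>When any two elements are comparable by scaling, a finite nonempty set has an element of
  which all the others are multiples. The locale form serves both R over itself and K over
  R.\<close>

lemma (in module) span_eq_span_singleton:
  assumes "finite A" "A \<noteq> {}"
    and "\<And>a b. \<exists>r. a = scale r b \<or> b = scale r a"
  shows "\<exists>x\<in>A. span A = span {x}"
  using assms(1,2)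
proof (induction A rule: finite_ne_induct)
  case (insert a A)
  then obtain x where x: "x \<in> A" "span A = span {x}" by blast
  have eq: "span (insert a A) = span {b}"
    if "insert a A \<subseteq> span {b}" "b \<in> insert a A" for b
  proof
    show "span (insert a A) \<subseteq> span {b}" using that(1) by (intro span_minimal) auto
    show "span {b} \<subseteq> span (insert a A)" using that(2) by (intro span_mono) auto
  qed
  have A: "A \<subseteq> span {x}" using span_superset[of A] x(2) by simp
  obtain r where "a = scale r x \<or> x = scale r a" using assms(3) by blast
  then show ?case
  proof
    assume "a = scale r x"
    then have "a \<in> span {x}" by (simp add: span_base span_scale)
    then show ?thesis using eq[of x] A x(1) by auto
  next
    assume "x = scale r a"
    then have "{x} \<subseteq> span {a}" by (simp add: span_base span_scale)
    then have "span {x} \<subseteq> span {a}" by (rule span_minimal) simp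
    then show ?thesis using eq[of a] A span_base[of a "{a}"] by auto
  qed
qed simp

lemma ideals_iff:
  "I \<in> ideals \<longleftrightarrow> 0 \<in> I \<and> (\<forall>x\<in>I. \<forall>y\<in>I. x + y \<in> I) \<and> (\<forall>r. \<forall>x\<in>I. r * x \<in> I)"
  by (simp add: ideals_def module.subspace_def[OF module_ring])

lemma Fbar_iff:
  "I \<in> Fbar \<longleftrightarrow>
     0 \<in> I \<and> (\<forall>x\<in>I. \<forall>y\<in>I. x + y \<in> I) \<and> (\<forall>r. \<forall>x\<in>I. to_fract r * x \<in> I) \<and> I \<noteq> {0}"
  by (simp add: Fbar_def module.subspace_def[OF module_frac] frac_scale_def)

lemma principal_in_ideals: "{y. x dvd y} \<in> ideals"
  by (simp add: ideals_iff)

lemma principal_subset_ideal: "I \<in> ideals \<Longrightarrow> x \<in> I \<Longrightarrow> {y. x dvd y} \<subseteq> I"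
  by (auto simp: ideals_iff dvd_def mult.commute)

lemma principal_in_fg_ideals: "{y. x dvd y} \<in> fg_ideals"
proof -
  have "{y. x dvd y} = range (\<lambda>k. k * x)"
    by (auto simp: dvd_def image_iff mult.commute)
  also have "\<dots> = module.span (*) {x}"
    by (simp add: module.span_singleton[OF module_ring])
  finally show ?thesis unfolding fg_ideals_def by blast
qed

lemma image_ideal_in_Fbar:
  assumes "I \<in> ideals" "I \<noteq> {0}"
  shows "to_fract ` I \<in> Fbar"
proof -
  obtain x where "x \<in> I" "x \<noteq> 0" using assms by (auto simp: ideals_iff)
  then have "to_fract ` I \<noteq> {0}" by (metis imageI singletonD to_fract_eq_0_iff)
  then show ?thesis
    using assms(1) by (force simp: Fbar_iff ideals_iff simp flip: to_fract_add to_fract_mult)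
qed

lemma range_to_fract_in_Fbar: "range (to_fract :: 'a::idom \<Rightarrow> _) \<in> Fbar"
proof (rule image_ideal_in_Fbar)
  show "(UNIV :: 'a set) \<noteq> {0}" by (metis UNIV_I singletonD zero_neq_one)
qed (simp add: ideals_iff)

lemma scale_in_Fbar:
  assumes "I \<in> Fbar" "x \<noteq> 0"
  shows "(*) x ` I \<in> Fbar"
proof -
  obtain y where "y \<in> I" "y \<noteq> 0" using assms(1) by (auto simp: Fbar_iff)
  then have "(*) x ` I \<noteq> {0}" using assms(2) by (metis imageI mult_eq_0_iff singletonD)
  moreover have "x * y + x * z \<in> (*) x ` I" if "y \<in> I" "z \<in> I" for y z
    using assms(1) that by (auto simp: Fbar_iff simp flip: distrib_left)
  moreover have "to_fract r * (x * y) \<in> (*) x ` I" if "y \<in> I" for r y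
    using assms(1) that by (auto simp: Fbar_iff mult.left_commute[of _ x])
  ultimately show ?thesis
    using assms(1) by (auto simp: Fbar_iff)
qed

lemma image_principal: "to_fract ` {y. x dvd y} = (*) (to_fract x) ` range to_fract"
  by (force simp: dvd_def simp flip: to_fract_mult)

lemma image_principal_mult:
  "to_fract ` {z. x * y dvd z} = (*) (to_fract x) ` to_fract ` {z. y dvd z}"
  by (force simp: dvd_def mult.assoc)

lemma mem_Fbar_imp_scale_subset:
  "I \<in> Fbar \<Longrightarrow> x \<in> I \<Longrightarrow> (*) x ` range to_fract \<subseteq> I"
  by (auto simp: Fbar_iff mult.commute[of x])

lemma ex_to_fract_mult_eq:
  fixes x :: "'a::idom fract"
  obtains r s where "s \<noteq> 0" "to_fract s * x = to_fract r"
proof (cases x)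
  case (Fract a b)
  then have "to_fract b * x = to_fract a" by (simp add: Fract_conv_to_fract)
  with that Fract show ?thesis by blast
qed

section \<open>Valuation domains: finitely generated modules are principal\<close>

lemma valuation_domain_dvd:
  fixes x y :: "'a::idom"
  assumes "valuation_domain TYPE('a)"
  shows "x dvd y \<or> y dvd x"
proof (cases "x = 0 \<or> y = 0")
  case False
  then have "to_fract y / to_fract x \<in> range to_fract \<or>
      inverse (to_fract y / to_fract x) \<in> range to_fract"
    using assms unfolding valuation_domain_def by (metis divide_eq_0_iff to_fract_eq_0_iff)
  then obtain r where "to_fract y / to_fract x = to_fract r \<or> to_fract x / to_fract y = to_fract r"
    by auto
  then have "to_fract y = to_fract (x * r) \<or> to_fract x = to_fract (y * r)"
    using False by (auto simp: field_simps)
  then show ?thesis by (metis dvd_triv_left to_fract_eq_iff)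
qed auto

lemma valuation_domain_fg_Fbar:
  fixes J :: "'a::idom fract set"
  assumes "valuation_domain TYPE('a)" "J \<in> fg_Fbar"
  obtains x where "x \<in> J" "x \<noteq> 0" "J = (*) x ` range to_fract"
proof -
  obtain A where A: "finite A" "J = module.span frac_scale A" and J: "J \<in> Fbar"
    using assms(2) by (auto simp: fg_Fbar_def)
  \<comment> \<open>An empty generating set would span \<open>{0}\<close>, which \<open>Fbar\<close>
    excludes.\<close>
  have "A \<noteq> {}"
    using A(2) J by (auto simp: module.span_empty[OF module_frac] Fbar_iff)
  have comparable: "\<exists>r. a = frac_scale r b \<or> b = frac_scale r a" for a b :: "'a fract"
  proof (cases "a = 0 \<or> b = 0")
    case True
    then show ?thesis by (auto simp: frac_scale_def intro!: exI[of _ 0])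
  next
    case False
    then have "a / b \<in> range to_fract \<or> inverse (a / b) \<in> range to_fract"
      using assms(1) unfolding valuation_domain_def by (metis divide_eq_0_iff)
    then obtain r where "a / b = to_fract r \<or> b / a = to_fract r" by auto
    then show ?thesis using False by (auto simp: frac_scale_def field_simps)
  qed
  obtain x where "x \<in> A" "J = module.span frac_scale {x}"
    using module.span_eq_span_singleton[OF module_frac A(1) \<open>A \<noteq> {}\<close> comparable] A(2) by auto
  then have "J = (*) x ` range to_fract"
    by (auto simp: module.span_singleton[OF module_frac] frac_scale_def mult.commute)
  moreover have "x \<in> J"
    using \<open>x \<in> A\<close> A(2) by (simp add: module.span_base[OF module_frac])
  moreover have "x \<noteq> 0" using J calculation(1) by (auto simp: Fbar_iff)
  ultimately show thesis using that by blast
qed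

lemma valuation_domain_fg_ideal:
  fixes J :: "'a::idom set"
  assumes "valuation_domain TYPE('a)" "J \<in> fg_ideals" "J \<noteq> {0}"
  obtains x where "x \<in> J" "J = {y. x dvd y}"
proof -
  obtain A where A: "finite A" "J = module.span (*) A"
    using assms(2) by (auto simp: fg_ideals_def)
  have "A \<noteq> {}"
    using A(2) assms(3) by (auto simp: module.span_empty[OF module_ring])
  moreover have "\<exists>r. a = r * b \<or> b = r * a" for a b :: 'a
    using valuation_domain_dvd[OF assms(1), of a b] by (auto simp: dvd_def mult.commute)
  ultimately obtain x where "J = module.span (*) {x}"
    using module.span_eq_span_singleton[OF module_ring A(1)] A(2) by metis
  then have "J = {y. x dvd y}"
    by (auto simp: module.span_singleton[OF module_ring] dvd_def mult.commute)
  then show thesis using that[of x] by simp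
qed

subsection \<open>The localizing system of a semistar operation\<close>

text \<open>
  For a semistar operation \<open>s\<close>, the condition \<open>1 \<in> s I\<close> says that \<open>s I = s R\<close>; see
  \<open>semistar_eq_range_iff\<close> below.
\<close>

definition unit_ideals :: "('a::idom fract set \<Rightarrow> 'a fract set) \<Rightarrow> 'a set set" where
  "unit_ideals s = {I \<in> ideals. I \<noteq> {0} \<and> 1 \<in> s (to_fract ` I)}"

context
  fixes s :: "'a::idom fract set \<Rightarrow> 'a fract set"
  assumes s: "semistar s"
begin

lemma semistar_closed: "I \<in> Fbar \<Longrightarrow> s I \<in> Fbar"
  and semistar_extensive: "I \<in> Fbar \<Longrightarrow> I \<subseteq> s I"
  and semistar_mono: "I \<in> Fbar \<Longrightarrow> J \<in> Fbar \<Longrightarrow> I \<subseteq> J \<Longrightarrow> s I \<subseteq> s J"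
  and semistar_scale: "I \<in> Fbar \<Longrightarrow> x \<noteq> 0 \<Longrightarrow> s ((*) x ` I) = (*) x ` s I"
  and semistar_idem: "I \<in> Fbar \<Longrightarrow> s (s I) = s I"
  using s by (simp_all add: semistar_def)

text \<open>The usual closure argument: \<open>s J\<close> is already closed, so it absorbs the
  closure of whatever it contains.\<close>

lemma semistar_subset: "I \<in> Fbar \<Longrightarrow> J \<in> Fbar \<Longrightarrow> I \<subseteq> s J \<Longrightarrow> s I \<subseteq> s J"
  using semistar_mono[of I "s J"] by (simp add: semistar_closed semistar_idem)

text \<open>Since \<open>s\<close> of the image of \<open>I\<close> is an R-module, containing 1
  means containing R, hence also the closure of R.\<close>

lemma semistar_eq_range_iff:
  assumes "I \<in> ideals" "I \<noteq> {0}"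
  shows "s (to_fract ` I) = s (range to_fract) \<longleftrightarrow> 1 \<in> s (to_fract ` I)"
proof
  note I = image_ideal_in_Fbar[OF assms]
  show "1 \<in> s (to_fract ` I)" if "s (to_fract ` I) = s (range to_fract)"
    unfolding that using semistar_extensive[OF range_to_fract_in_Fbar] to_fract_1
    by (metis range_eqI subsetD)
  show "s (to_fract ` I) = s (range to_fract)" if "1 \<in> s (to_fract ` I)"
  proof
    show "s (to_fract ` I) \<subseteq> s (range to_fract)"
      by (intro semistar_mono I range_to_fract_in_Fbar) auto
    have "range to_fract \<subseteq> s (to_fract ` I)"
      using mem_Fbar_imp_scale_subset[OF semistar_closed[OF I] that] by simp
    then show "s (range to_fract) \<subseteq> s (to_fract ` I)"
      by (intro semistar_subset I range_to_fract_in_Fbar)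
  qed
qed

lemma UNIV_in_unit_ideals: "UNIV \<in> unit_ideals s"
proof -
  have "(UNIV :: 'a set) \<noteq> {0}" by (metis UNIV_I singletonD zero_neq_one)
  moreover have "(UNIV :: 'a set) \<in> ideals" by (simp add: ideals_iff)
  ultimately show ?thesis
    using semistar_eq_range_iff[of UNIV] by (simp add: unit_ideals_def)
qed

lemma unit_ideals_upward:
  assumes "I \<in> unit_ideals s" "J \<in> ideals" "I \<subseteq> J"
  shows "J \<in> unit_ideals s"
proof -
  have I: "I \<in> ideals" "I \<noteq> {0}" "1 \<in> s (to_fract ` I)"
    using assms(1) by (auto simp: unit_ideals_def)
  have "J \<noteq> {0}" using I assms(3) by (auto simp: ideals_iff)
  moreover have "s (to_fract ` I) \<subseteq> s (to_fract ` J)"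
    using I assms \<open>J \<noteq> {0}\<close> by (intro semistar_mono image_ideal_in_Fbar) auto
  ultimately show ?thesis using I assms(2) by (auto simp: unit_ideals_def)
qed

text \<open>Scaling turns 1 in s(yR) into x in s(xyR). Thus xR lies in s(xyR), and closing up gives
  1 in s(xR), which lies in s(xyR).\<close>

lemma principal_mult_in_unit_ideals:
  assumes "{z. x dvd z} \<in> unit_ideals s" "{z. y dvd z} \<in> unit_ideals s"
  shows "{z. x * y dvd z} \<in> unit_ideals s"
proof -
  have x: "{z. x dvd z} \<noteq> {0}" "1 \<in> s (to_fract ` {z. x dvd z})"
    and y: "{z. y dvd z} \<noteq> {0}" "1 \<in> s (to_fract ` {z. y dvd z})"
    using assms by (auto simp: unit_ideals_def)
  have "x \<noteq> 0" "y \<noteq> 0" using x(1) y(1) by auto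
  then have nz: "{z. x * y dvd z} \<noteq> {0}"
    by (metis dvd_refl mem_Collect_eq mult_eq_0_iff singletonD)
  have F: "to_fract ` {z. x dvd z} \<in> Fbar" "to_fract ` {z. y dvd z} \<in> Fbar"
      "to_fract ` {z. x * y dvd z} \<in> Fbar"
    using x(1) y(1) nz by (simp_all add: image_ideal_in_Fbar principal_in_ideals)
  have "s (to_fract ` {z. x * y dvd z}) = (*) (to_fract x) ` s (to_fract ` {z. y dvd z})"
    unfolding image_principal_mult using \<open>x \<noteq> 0\<close> by (intro semistar_scale F) simp
  then have "to_fract x \<in> s (to_fract ` {z. x * y dvd z})"
    using y(2) by (metis image_eqI mult.right_neutral)
  then have "to_fract ` {z. x dvd z} \<subseteq> s (to_fract ` {z. x * y dvd z})"
    using mem_Fbar_imp_scale_subset[OF semistar_closed[OF F(3)]] by (simp add: image_principal)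
  then have "s (to_fract ` {z. x dvd z}) \<subseteq> s (to_fract ` {z. x * y dvd z})"
    by (intro semistar_subset F)
  then show ?thesis
    using x(2) nz by (auto simp: unit_ideals_def principal_in_ideals)
qed

text \<open>A stable \<open>t\<close> is recovered from its unit ideals: x in t(I) forces the colon
  ideal (I : x) to be one of them. Conversely, if (I : x) is a unit ideal of \<open>s\<close>,
  multiplying by x gives x in s(I).\<close>

lemma semistar_le_if_unit_ideals_subset:
  assumes t: "semistar_stable t" "semistar t"
    and sub: "unit_ideals t \<subseteq> unit_ideals s" and I: "I \<in> Fbar"
  shows "t I \<subseteq> s I"
proof
  fix x assume x: "x \<in> t I"
  show "x \<in> s I"
  proof (cases "x = 0")
    case True
    then show ?thesis using semistar_closed[OF I] by (simp add: Fbar_iff)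
  next
    case False
    define X where "X = (*) x ` range to_fract"
    \<comment> \<open>This is the colon ideal of x into \<open>I\<close>, chosen so that I meets xR
      exactly in xJ.\<close>
    define J where "J = {r. to_fract r * x \<in> I}"
    have X: "X \<in> Fbar"
      unfolding X_def using False by (intro scale_in_Fbar range_to_fract_in_Fbar)
    have J: "J \<in> ideals"
      using I by (auto simp: J_def ideals_iff Fbar_iff distrib_right mult.assoc)
    have IX: "I \<inter> X = (*) x ` to_fract ` J"
      by (auto simp: J_def X_def mult.commute)
    have "J \<noteq> {0}"
    proof -
      \<comment> \<open>A denominator b of x/y works for any nonzero y in \<open>I\<close>: bx = ay
        lies in \<open>I\<close>.\<close>
      obtain y where y: "y \<in> I" "y \<noteq> 0" using I by (auto simp: Fbar_iff)
      obtain a b where ab: "b \<noteq> 0" "to_fract b * (x / y) = to_fract a"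
        by (rule ex_to_fract_mult_eq)
      have "to_fract b * x = to_fract a * y"
        using ab(2) y(2) by (simp add: field_simps)
      then have "b \<in> J"
        using I y(1) by (simp add: J_def Fbar_iff)
      then show ?thesis using ab(1) by auto
    qed
    note F = image_ideal_in_Fbar[OF J this]
    have "x \<in> X" unfolding X_def by (metis image_eqI mult.right_neutral range_eqI to_fract_1)
    moreover have "X \<subseteq> t X" using X t(2) by (simp add: semistar_def)
    ultimately have "x \<in> t X" by blast
    \<comment> \<open>Stability enters here: x lies in both t(I) and t(X). Dividing by x then moves
      the question into R.\<close>
    then have "x \<in> t (I \<inter> X)"
      using t(1) I X x by (simp add: semistar_stable_def)
    also have "t (I \<inter> X) = (*) x ` t (to_fract ` J)"
      unfolding IX using t(2) F False by (simp add: semistar_def)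
    finally have "1 \<in> t (to_fract ` J)" using False by auto
    then have "J \<in> unit_ideals s"
      using J \<open>J \<noteq> {0}\<close> sub by (auto simp: unit_ideals_def)
    then have "1 \<in> s (to_fract ` J)" by (simp add: unit_ideals_def)
    then have "x \<in> (*) x ` s (to_fract ` J)" by (metis image_eqI mult.right_neutral)
    also have "\<dots> = s (I \<inter> X)"
      unfolding IX by (rule semistar_scale[OF F False, symmetric])
    also have "\<dots> \<subseteq> s I"
      using scale_in_Fbar[OF F False] I by (intro semistar_mono) (auto simp: IX[symmetric])
    finally show ?thesis .
  qed
qed

section \<open>Finite type operations over a valuation domain\<close>

context
  assumes valuation: "valuation_domain TYPE('a)" and finite_type: "semistar_finite_type s"
begin

text \<open>Finite type puts 1 into the closure of a finitely generated submodule of the image of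
  \<open>I\<close>. That submodule is principal, and its generator comes from an element of
  \<open>I\<close>.\<close>

lemma unit_ideals_principal:
  assumes "I \<in> unit_ideals s"
  obtains x where "x \<in> I" "{y. x dvd y} \<in> unit_ideals s"
proof -
  have I: "I \<in> ideals" "I \<noteq> {0}" "1 \<in> s (to_fract ` I)"
    using assms by (auto simp: unit_ideals_def)
  then obtain J where J: "J \<in> fg_Fbar" "J \<subseteq> to_fract ` I" "1 \<in> s J"
    using finite_type image_ideal_in_Fbar[OF I(1,2)] by (auto simp: semistar_finite_type_def)
  obtain z where z: "z \<in> J" "z \<noteq> 0" "J = (*) z ` range to_fract"
    using valuation_domain_fg_Fbar[OF valuation J(1)] .
  obtain x where x: "x \<in> I" "z = to_fract x" using z(1) J(2) by auto
  have "x \<noteq> 0" using x(2) z(2) by simp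
  then have "{y. x dvd y} \<noteq> {0}" by (metis dvd_refl mem_Collect_eq singletonD)
  moreover have "1 \<in> s (to_fract ` {y. x dvd y})"
    using J(3) by (simp only: image_principal z(3) x(2))
  ultimately show thesis
    using that[OF x(1)] by (simp add: unit_ideals_def principal_in_ideals)
qed

lemma localizing_system_unit_ideals: "localizing_system (unit_ideals s)"
  unfolding localizing_system_def
proof (intro conjI ballI impI)
  show "unit_ideals s \<noteq> {}" using UNIV_in_unit_ideals by auto
  show "unit_ideals s \<subseteq> ideals" by (auto simp: unit_ideals_def)
  show "J \<in> unit_ideals s" if "I \<in> unit_ideals s" "J \<in> ideals" "I \<subseteq> J" for I J
    using unit_ideals_upward that .
  fix I J assume I: "I \<in> unit_ideals s" and J: "J \<in> ideals"
    and colon: "\<forall>i\<in>I. {r. r * i \<in> J} \<in> unit_ideals s"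
  obtain x where x: "x \<in> I" "{y. x dvd y} \<in> unit_ideals s"
    using unit_ideals_principal[OF I] .
  \<comment> \<open>The colon condition is needed only at the generator x; the product yxR is then a
    unit ideal inside \<open>J\<close>.\<close>
  obtain y where y: "y * x \<in> J" "{z. y dvd z} \<in> unit_ideals s"
    using unit_ideals_principal[of "{r. r * x \<in> J}"] colon x(1) by auto
  show "J \<in> unit_ideals s"
    using principal_mult_in_unit_ideals[OF y(2) x(2)] J principal_subset_ideal[OF J y(1)]
    by (rule unit_ideals_upward)
qed

lemma finite_type_family_unit_ideals: "finite_type_family (unit_ideals s)"
  unfolding finite_type_family_def
proof
  fix I assume I: "I \<in> unit_ideals s"
  then obtain x where x: "x \<in> I" "{y. x dvd y} \<in> unit_ideals s"
    by (rule unit_ideals_principal)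
  then have "{y. x dvd y} \<subseteq> I"
    using I by (intro principal_subset_ideal) (auto simp: unit_ideals_def)
  then show "\<exists>J\<in>unit_ideals s. J \<in> fg_ideals \<and> J \<subseteq> I"
    using x principal_in_fg_ideals by blast
qed

end

end

subsection \<open>Chains of semistar operations\<close>

lemma G_antimono: "m \<le> n \<Longrightarrow> G \<nu> n \<subseteq> G \<nu> m"
  by (auto simp: G_def intro: order_trans[of "enat m" "enat n"])

text \<open>True for any function into the extended naturals: the sets \<open>G\<close> are constant
  from \<open>m\<close> on exactly when no finite value is at least \<open>m\<close>.\<close>

lemma finite_image_iff_Inter_G:
  "finite (\<nu> ` ideals) \<longleftrightarrow> (\<exists>m. (\<Inter>n. G \<nu> n) = G \<nu> m)"
proof
  assume "finite (\<nu> ` ideals)"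
  \<comment> \<open>The preimage under \<open>enat\<close> discards the value infinity, so a bound
    \<open>N\<close> exceeds all finite values and membership in \<open>G \<nu> N\<close> forces the
    value infinity.\<close>
  then have "finite (enat -` (\<nu> ` ideals))"
    by (intro finite_vimageI) (auto simp: inj_on_def)
  then obtain N where N: "\<forall>n\<in>enat -` (\<nu> ` ideals). n < N"
    using finite_nat_set_iff_bounded by auto
  have "J \<in> (\<Inter>n. G \<nu> n)" if "J \<in> G \<nu> N" for J
  proof -
    have J: "J \<in> ideals" "enat N \<le> \<nu> J" using that by (auto simp: G_def)
    have "\<nu> J = \<infinity>"
    proof (cases "\<nu> J")
      case (enat k)
      then have "k < N" using N J(1) by (metis imageI vimageI2)
      then show ?thesis using enat J(2) by simp
    qed
    then show ?thesis using J(1) by (simp add: G_def)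
  qed
  then show "\<exists>m. (\<Inter>n. G \<nu> n) = G \<nu> m" by blast
next
  assume "\<exists>m. (\<Inter>n. G \<nu> n) = G \<nu> m"
  then obtain m where m: "(\<Inter>n. G \<nu> n) = G \<nu> m" ..
  have "\<nu> J \<in> insert \<infinity> (enat ` {..<m})" if "J \<in> ideals" for J
  proof (cases "\<nu> J")
    case (enat k)
    have "k < m"
    proof (rule ccontr)
      assume "\<not> k < m"
      then have "J \<in> G \<nu> m" using that enat by (simp add: G_def)
      \<comment> \<open>Being in \<open>G \<nu> m\<close> means being in every level, including the
        one just above the actual value \<open>k\<close>.\<close>
      then have "J \<in> G \<nu> (Suc k)" using m by blast
      then show False using enat by (simp add: G_def)
    qed
    then show ?thesis using enat by simp
  qed simp
  then have "\<nu> ` ideals \<subseteq> insert \<infinity> (enat ` {..<m})" by (rule image_subsetI)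
  then show "finite (\<nu> ` ideals)" by (rule finite_subset) simp
qed

section \<open>Standard chains: levels of the function nu as unit ideals\<close>

context
  fixes C :: "nat \<Rightarrow> 'a::idom fract set \<Rightarrow> 'a fract set"
  assumes chain: "standard_chain C"
begin

lemma chain_semistar: "semistar (C n)"
  and chain_finite_type: "semistar_finite_type (C n)"
  and chain_stable: "semistar_stable (C n)"
  using chain by (auto simp: standard_chain_def)

lemma chain_antimono: "I \<in> Fbar \<Longrightarrow> m \<le> n \<Longrightarrow> C n I \<subseteq> C m I"
  using chain lift_Suc_antimono_le[of "\<lambda>n. C n I" m n]
  by (auto simp: standard_chain_def semistar_ge_def)

lemma unit_ideals_antimono:
  assumes "m \<le> n"
  shows "unit_ideals (C n) \<subseteq> unit_ideals (C m)"
  using chain_antimono[OF image_ideal_in_Fbar assms] by (auto simp: unit_ideals_def)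

text \<open>The indices k for which \<open>I\<close> is a unit ideal of \<open>C k\<close> form a
  down-closed set containing 0, so the supremum reaches n exactly when n is one of them, even if it
  is infinite.\<close>

lemma enat_le_chain_nu_iff:
  assumes "I \<in> ideals" "I \<noteq> {0}"
  shows "enat n \<le> chain_nu C I \<longleftrightarrow> I \<in> unit_ideals (C n)"
proof -
  define K where "K = {k. I \<in> unit_ideals (C k)}"
  have nu: "chain_nu C I = (SUP k\<in>K. enat k)"
    using assms by (simp add: chain_nu_def K_def unit_ideals_def
        semistar_eq_range_iff[OF chain_semistar])
  have down: "m \<in> K" if "k \<in> K" "m \<le> k" for k m
    using that unit_ideals_antimono[of m k] by (auto simp: K_def)
  have "1 \<in> C 0 (to_fract ` I)"
    using chain image_ideal_in_Fbar[OF assms] by (simp add: standard_chain_def semistar_e_def)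
  then have "0 \<in> K" using assms by (simp add: K_def unit_ideals_def)
  have "enat n \<le> (SUP k\<in>K. enat k) \<longleftrightarrow> n \<in> K"
  proof
    assume le: "enat n \<le> (SUP k\<in>K. enat k)"
    show "n \<in> K"
    proof (rule ccontr)
      assume "n \<notin> K"
      then have lt: "k < n" if "k \<in> K" for k using down[of k n] that by force
      \<comment> \<open>Truncated subtraction is harmless: 0 belongs to \<open>K\<close> and all of
        \<open>K\<close> lies below n, so n is positive.\<close>
      then have "(SUP k\<in>K. enat k) \<le> enat (n - 1)" by (force intro!: SUP_least)
      with le have "n \<le> n - 1" by (metis enat_ord_simps(1) order_trans)
      then show False using lt[OF \<open>0 \<in> K\<close>] by simp
    qed
  qed (rule SUP_upper)
  then show ?thesis by (simp add: nu K_def)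
qed

text \<open>For \<open>n = 0\<close> this fails: \<open>G (chain_nu C) 0\<close> contains the zero ideal.\<close>

lemma G_chain_nu:
  assumes "0 < n"
  shows "G (chain_nu C) n = unit_ideals (C n)"
proof -
  have "{0} \<notin> G (chain_nu C) n"
    using assms by (simp add: G_def chain_nu_def zero_enat_def)
  then have "J \<in> G (chain_nu C) n \<longleftrightarrow> J \<in> unit_ideals (C n)" for J
    using enat_le_chain_nu_iff[of J n] unfolding G_def unit_ideals_def by blast
  then show ?thesis by blast
qed

text \<open>The two families differ only at index 0; both descend, so shifting by \<open>Suc\<close>
  leaves the intersections unchanged.\<close>

lemma Inter_G_chain_nu: "(\<Inter>n. G (chain_nu C) n) = (\<Inter>n. unit_ideals (C n))"
proof
  show "(\<Inter>n. G (chain_nu C) n) \<subseteq> (\<Inter>n. unit_ideals (C n))"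
  proof
    fix J assume "J \<in> (\<Inter>n. G (chain_nu C) n)"
    then have "J \<in> unit_ideals (C (Suc n))" for n by (auto simp flip: G_chain_nu)
    then show "J \<in> (\<Inter>n. unit_ideals (C n))"
      using unit_ideals_antimono[OF le_SucI[OF order_refl]] by blast
  qed
  show "(\<Inter>n. unit_ideals (C n)) \<subseteq> (\<Inter>n. G (chain_nu C) n)"
  proof
    fix J assume "J \<in> (\<Inter>n. unit_ideals (C n))"
    then have "J \<in> G (chain_nu C) (Suc n)" for n by (auto simp: G_chain_nu)
    then show "J \<in> (\<Inter>n. G (chain_nu C) n)"
      using G_antimono[OF le_SucI[OF order_refl]] by blast
  qed
qed

lemma Inter_G_eq_unit_ideals:
  assumes "(\<Inter>n. G (chain_nu C) n) = G (chain_nu C) m"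
  shows "(\<Inter>n. unit_ideals (C n)) = unit_ideals (C m)"
proof -
  \<comment> \<open>The zero ideal separates level 0 from the intersection, so stabilisation cannot
    occur there.\<close>
  have "m \<noteq> 0"
  proof
    assume "m = 0"
    moreover have "{0} \<in> G (chain_nu C) 0" by (simp add: G_def ideals_iff flip: zero_enat_def)
    ultimately have "{0} \<in> (\<Inter>n. unit_ideals (C n))" using assms Inter_G_chain_nu by simp
    then show False by (simp add: unit_ideals_def)
  qed
  then show ?thesis using assms by (simp add: Inter_G_chain_nu G_chain_nu)
qed

text \<open>Every unit ideal of \<open>C m\<close> is one of every \<open>C n\<close>, so
  \<open>C m\<close> is the smallest operation of the chain. Hence \<open>chain_star C\<close>
  agrees with it on \<open>Fbar\<close> and inherits finite type.\<close>

lemma chain_star_finite_type_if_stationary: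
  assumes m: "(\<Inter>n. unit_ideals (C n)) = unit_ideals (C m)"
  shows "semistar_finite_type (chain_star C)"
proof -
  have eq: "chain_star C I = C m I" if I: "I \<in> Fbar" for I
  proof -
    have "C m I \<subseteq> C n I" for n
      using m by (intro semistar_le_if_unit_ideals_subset chain_semistar chain_stable I) auto
    then show ?thesis by (auto simp: chain_star_def)
  qed
  show ?thesis
    unfolding semistar_finite_type_def
  proof
    fix I :: "'a fract set" assume I: "I \<in> Fbar"
    then have "chain_star C I = (\<Union>J \<in> {J \<in> fg_Fbar. J \<subseteq> I}. C m J)"
      using chain_finite_type[of m] unfolding eq[OF I] semistar_finite_type_def
      by (rule bspec[rotated])
    also have "\<dots> = (\<Union>J \<in> {J \<in> fg_Fbar. J \<subseteq> I}. chain_star C J)"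
      by (rule SUP_cong) (simp_all add: eq fg_Fbar_def)
    finally show "chain_star C I = (\<Union>J \<in> {J \<in> fg_Fbar. J \<subseteq> I}. chain_star C J)" .
  qed
qed

section \<open>Non-stationary chains over a valuation domain\<close>

context
  assumes valuation: "valuation_domain TYPE('a)"
begin

lemma non_stationary_ideal:
  assumes "\<nexists>m. (\<Inter>n. G (chain_nu C) n) = G (chain_nu C) m"
  obtains P where "P \<in> (\<Inter>n. unit_ideals (C n))"
    and "\<And>x. x \<in> P \<Longrightarrow> {y. x dvd y} \<notin> (\<Inter>n. unit_ideals (C n))"
proof -
  define P where "P = {x. {y. x dvd y} \<notin> (\<Inter>n. unit_ideals (C n))}"
  \<comment> \<open>If y divided by x left \<open>P\<close>, the larger ideal xR would also belong
    to every level.\<close>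
  have dvdP: "y \<in> P" if "x \<in> P" "x dvd y" for x y
  proof (rule ccontr)
    assume "y \<notin> P"
    then have "{z. x dvd z} \<in> unit_ideals (C n)" for n
      using that(2) unit_ideals_upward[OF chain_semistar, of "{z. y dvd z}" n "{z. x dvd z}"]
      by (auto simp: P_def principal_in_ideals intro: dvd_trans)
    then show False using that(1) by (simp add: P_def)
  qed
  have zero: "{y :: 'a. 0 dvd y} = {0}" by auto
  have "0 \<in> P" unfolding P_def mem_Collect_eq zero by (simp add: unit_ideals_def)
  \<comment> \<open>One of x and y divides the other, hence divides the sum.\<close>
  moreover have "x + y \<in> P" if "x \<in> P" "y \<in> P" for x y
    using valuation_domain_dvd[OF valuation, of x y] dvdP[of x "x + y"] dvdP[of y "x + y"] that
    by auto
  ultimately have P: "P \<in> ideals" using dvdP by (auto simp: ideals_iff)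
  have "P \<in> unit_ideals (C n)" for n
  proof -
    \<comment> \<open>The index \<open>Suc n\<close> is positive, so \<open>G\<close> there is a
      family of unit ideals. An \<open>I\<close> in it but outside the intersection has a principal
      subideal xR at level n; xR cannot lie in every level, so x is in \<open>P\<close>.\<close>
    have "(\<Inter>k. G (chain_nu C) k) \<noteq> G (chain_nu C) (Suc n)" using assms by blast
    then obtain I where I: "I \<in> unit_ideals (C (Suc n))" "I \<notin> (\<Inter>k. unit_ideals (C k))"
      by (auto simp: Inter_G_chain_nu G_chain_nu)
    then have In: "I \<in> unit_ideals (C n)" using unit_ideals_antimono[of n "Suc n"] by auto
    obtain x where x: "x \<in> I" "{y. x dvd y} \<in> unit_ideals (C n)"
      using unit_ideals_principal[OF chain_semistar valuation chain_finite_type In] .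
    have sub: "{y. x dvd y} \<subseteq> I" and "I \<in> ideals"
      using In x(1) by (auto simp: unit_ideals_def dest: principal_subset_ideal)
    then have "{y. x dvd y} \<notin> (\<Inter>k. unit_ideals (C k))"
      using I(2) unit_ideals_upward[OF chain_semistar] by blast
    then have "x \<in> P" by (simp add: P_def)
    then show ?thesis
      using unit_ideals_upward[OF chain_semistar x(2) P] principal_subset_ideal[OF P] by blast
  qed
  then show thesis by (intro that[of P]) (auto simp: P_def)
qed

text \<open>Otherwise finite type would yield a principal member of the intersection inside the
  ideal \<open>P\<close> of \<open>non_stationary_ideal\<close>, which has none.\<close>

lemma stationary_if_finite_type_family:
  assumes "finite_type_family (\<Inter>n. G (chain_nu C) n)"
  shows "\<exists>m. (\<Inter>n. G (chain_nu C) n) = G (chain_nu C) m"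
proof (rule ccontr)
  assume "\<nexists>m. (\<Inter>n. G (chain_nu C) n) = G (chain_nu C) m"
  then obtain P where P: "P \<in> (\<Inter>n. unit_ideals (C n))"
    "\<And>x. x \<in> P \<Longrightarrow> {y. x dvd y} \<notin> (\<Inter>n. unit_ideals (C n))"
    by (rule non_stationary_ideal) blast
  have "\<exists>J\<in>(\<Inter>n. unit_ideals (C n)). J \<in> fg_ideals \<and> J \<subseteq> P"
    using assms unfolding finite_type_family_def Inter_G_chain_nu by (rule bspec[OF _ P(1)])
  then obtain J where J: "J \<in> (\<Inter>n. unit_ideals (C n))" "J \<in> fg_ideals" "J \<subseteq> P"
    by auto
  then have "J \<noteq> {0}" by (auto simp: unit_ideals_def)
  with J(2) obtain x where "x \<in> J" "J = {y. x dvd y}"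
    by (rule valuation_domain_fg_ideal[OF valuation])
  then show False using P(2)[of x] J(1,3) by blast
qed

lemma stationary_if_chain_star_finite_type:
  assumes "semistar_finite_type (chain_star C)"
  shows "\<exists>m. (\<Inter>n. G (chain_nu C) n) = G (chain_nu C) m"
proof (rule ccontr)
  assume "\<nexists>m. (\<Inter>n. G (chain_nu C) n) = G (chain_nu C) m"
  then obtain P where P: "P \<in> (\<Inter>n. unit_ideals (C n))"
    "\<And>x. x \<in> P \<Longrightarrow> {y. x dvd y} \<notin> (\<Inter>n. unit_ideals (C n))"
    by (rule non_stationary_ideal) blast
  have "P \<in> ideals" "P \<noteq> {0}" "1 \<in> chain_star C (to_fract ` P)"
    using P(1) by (auto simp: unit_ideals_def chain_star_def)
  \<comment> \<open>As 1 lies in every closure of \<open>P\<close>, finite type supplies such a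
    \<open>J\<close>. It is the image of some xR with x in \<open>P\<close>, and xR is then a unit
    ideal at every level.\<close>
  then obtain J where J: "J \<in> fg_Fbar" "J \<subseteq> to_fract ` P" "1 \<in> chain_star C J"
    using assms image_ideal_in_Fbar[of P] by (auto simp: semistar_finite_type_def)
  obtain z where z: "z \<in> J" "z \<noteq> 0" "J = (*) z ` range to_fract"
    using valuation_domain_fg_Fbar[OF valuation J(1)] .
  obtain x where x: "x \<in> P" "z = to_fract x" using z(1) J(2) by auto
  have "x \<noteq> 0" using x(2) z(2) by simp
  then have "{y. x dvd y} \<noteq> {0}" by (metis dvd_refl mem_Collect_eq singletonD)
  moreover have "J = to_fract ` {y. x dvd y}" by (simp only: image_principal z(3) x(2))
  ultimately have "{y. x dvd y} \<in> (\<Inter>n. unit_ideals (C n))"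
    using J(3) by (simp add: unit_ideals_def principal_in_ideals chain_star_def)
  then show False using P(2) x(1) by blast
qed

end

end

theorem corollary5:
  fixes C :: "nat \<Rightarrow> 'a::idom fract set \<Rightarrow> 'a fract set"
  assumes "valuation_domain TYPE('a)"
    and "standard_chain C"
  shows "(semistar_finite_type (chain_star C) \<longleftrightarrow> finite (chain_nu C ` ideals)) \<and>
         (finite (chain_nu C ` ideals) \<longleftrightarrow>
            localizing_system (\<Inter>n. G (chain_nu C) n) \<and>
            finite_type_family (\<Inter>n. G (chain_nu C) n)) \<and>
         (localizing_system (\<Inter>n. G (chain_nu C) n) \<and>
            finite_type_family (\<Inter>n. G (chain_nu C) n) \<longleftrightarrow>
          (\<exists>m. (\<Inter>n. G (chain_nu C) n) = G (chain_nu C) m))"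
proof -
  \<comment> \<open>Stationarity is the hub: each other condition is shown equivalent to it.\<close>
  let ?stationary = "\<exists>m. (\<Inter>n. G (chain_nu C) n) = G (chain_nu C) m"
  note val = assms(1) and chain = assms(2)
  have "semistar_finite_type (chain_star C)" if ?stationary
    using that by (elim exE)
      (intro chain_star_finite_type_if_stationary[OF chain] Inter_G_eq_unit_ideals[OF chain])
  moreover note stationary_if_chain_star_finite_type[OF chain val]
  moreover have "localizing_system (\<Inter>n. G (chain_nu C) n) \<and>
      finite_type_family (\<Inter>n. G (chain_nu C) n)" if stationary: ?stationary
  proof -
    obtain m where m: "(\<Inter>n. G (chain_nu C) n) = G (chain_nu C) m"
      using stationary ..
    \<comment> \<open>The intersection becomes the unit ideals of a single finite type operation, to
      which the results on one operation apply.\<close>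
    have "(\<Inter>n. G (chain_nu C) n) = unit_ideals (C m)"
      unfolding Inter_G_chain_nu[OF chain] by (rule Inter_G_eq_unit_ideals[OF chain m])
    then show ?thesis
      using chain_semistar[OF chain] chain_finite_type[OF chain]
      by (simp add: localizing_system_unit_ideals finite_type_family_unit_ideals val)
  qed
  ultimately show ?thesis
    using finite_image_iff_Inter_G[of "chain_nu C"] stationary_if_finite_type_family[OF chain val]
    by argo
qed

end
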